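(* Let $\langle d,k,m\rangle\in M_n\setminus\{\mathbf{0}\}$. If $d=0$ then $\langle d,k,m\rangle$ is idempotent; if $d\ne 0$ then it is nilpotent, and its nilpotency index $\ell$ (the smallest $j\in\mathbb{N}$ with $\langle d,k,m\rangle^j=\mathbf{0}$) is $$\ell=1+\left\lceil\frac{m-k+1}{|d|}\right\rceil,$$ and satisfies $2\le\ell\le n$.
   Context: Fix an integer $n\ge 2$. For integers $d,k,m$ with $1-\min(0,d)\le k\le m\le n-\max(0,d)$, let $\langle d,k,m\rangle$ denote the $n\times n$ matrix with entries $x_{ij}$ ($i,j\in\{1,\dots,n\}$) equal to $1$ if $k\le i\le m$ and $j-i=d$, and $0$ otherwise (it has $m-k+1$ ones). Let $\mathbf{0}$ be the $n\times n$ zero matrix and $M_n=\{\mathbf{0}\}\cup\{\langle d,k,m\rangle: d\in\mathbb{Z},\ k,m\in\mathbb{N},\ 1-\min(0,d)\le k\le m\le n-\max(0,d)\}$, a monoid under matrix multiplication. $\lceil t\rceil$ is the ceiling of $t$. *)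

theory Defs
  imports Complex_Main "Jordan_Normal_Form.Matrix"
begin

definition diag_params :: "nat \<Rightarrow> int \<Rightarrow> nat \<Rightarrow> nat \<Rightarrow> bool" where
  "diag_params n d k m \<longleftrightarrow>
     1 - min 0 d \<le> int k \<and> k \<le> m \<and> int m \<le> int n - max 0 d"

text \<open>
  Matrices of type \<^typ>\<open>'a mat\<close> have row and column indices starting at 0, so the entry
  in row \<open>i\<close> and column \<open>j\<close> below is the entry with indices \<open>i + 1\<close> and \<open>j + 1\<close> in the
  numbering by \<open>1, \<dots>, n\<close>. The shift cancels in the condition \<open>j - i = d\<close>.
\<close>

definition diag_segment :: "nat \<Rightarrow> int \<Rightarrow> nat \<Rightarrow> nat \<Rightarrow> 'a :: semiring_1 mat" where
  "diag_segment n d k m =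
     mat n n (\<lambda>(i, j). if k \<le> i + 1 \<and> i + 1 \<le> m \<and> int j - int i = d then 1 else 0)"

definition diag_monoid :: "nat \<Rightarrow> 'a :: semiring_1 mat set" where
  "diag_monoid n = {0\<^sub>m n n} \<union> {diag_segment n d k m | d k m. diag_params n d k m}"

definition idempotent_mat :: "'a :: semiring_1 mat \<Rightarrow> bool" where
  "idempotent_mat A \<longleftrightarrow> A * A = A"

definition nilpotent_mat :: "'a :: semiring_1 mat \<Rightarrow> bool" where
  "nilpotent_mat A \<longleftrightarrow> (\<exists>j. A ^\<^sub>m j = 0\<^sub>m (dim_row A) (dim_col A))"

text \<open>
  The exponent 0 is harmless here and in \<^const>\<open>nilpotent_mat\<close>: the zeroth power is the
  identity matrix, which is nonzero as soon as there is at least one row.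
\<close>

definition nilpotency_index :: "'a :: semiring_1 mat \<Rightarrow> nat" where
  "nilpotency_index A = (LEAST j. A ^\<^sub>m j = 0\<^sub>m (dim_row A) (dim_col A))"

end

theory Submission
  imports Defs
begin

text \<open>
  Regard \<open>\<langle>d, k, m\<rangle>\<close> as the partial translation \<open>i \<mapsto> i + d\<close> of the indices, defined for
  \<open>k \<le> i \<le> m\<close>. Composing two of them adds the distances and intersects the first domain with
  the preimage of the second, so the power with exponent \<open>r + 1\<close> is again a segment: its domain
  consists of those \<open>i\<close> for which \<open>i\<close> and \<open>i + r * d\<close> both lie in \<open>{k..m}\<close>. This domain is empty
  if and only if \<open>m - k < r * \<bar>d\<bar>\<close>.
\<close>

lemma diag_segment_carrier [simp]: "diag_segment n d k m \<in> carrier_mat n n"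
  by (simp add: diag_segment_def)

lemma dim_diag_segment [simp]:
  "dim_row (diag_segment n d k m) = n" "dim_col (diag_segment n d k m) = n"
  by (simp_all add: diag_segment_def)

lemma index_diag_segment:
  assumes "i < n" "j < n"
  shows "diag_segment n d k m $$ (i, j) =
    (if k \<le> i + 1 \<and> i + 1 \<le> m \<and> int j - int i = d then 1 else 0)"
  using assms by (simp add: diag_segment_def)

lemma index_diag_segment_mult:
  fixes B :: "'a :: semiring_1 mat"
  assumes B: "B \<in> carrier_mat n p" and i: "i < n" and j: "j < p"
  shows "(diag_segment n d k m * B) $$ (i, j) =
    (if k \<le> i + 1 \<and> i + 1 \<le> m \<and> 0 \<le> int i + d \<and> int i + d < int n
     then B $$ (nat (int i + d), j) else 0)"
proof -
  let ?row = "nat (int i + d)"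
  let ?in_range = "k \<le> i + 1 \<and> i + 1 \<le> m \<and> 0 \<le> int i + d"
  have "(diag_segment n d k m * B) $$ (i, j) =
      (\<Sum>l<n. diag_segment n d k m $$ (i, l) * B $$ (l, j))"
    using B i j by (auto simp: scalar_prod_def lessThan_atLeast0 intro!: sum.cong)
  also have "\<dots> = (\<Sum>l<n. if l = ?row then (if ?in_range then B $$ (l, j) else 0) else 0)"
    using i by (intro sum.cong) (auto simp: index_diag_segment)
  also have "\<dots> = (if ?in_range \<and> int i + d < int n then B $$ (?row, j) else 0)"
    by auto
  finally show ?thesis
    by simp
qed

text \<open>A negative upper end is truncated to 0, which still describes the empty segment.\<close>

lemma diag_segment_mult:
  assumes "1 \<le> k'" "m' \<le> n"
  shows "diag_segment n d k m * diag_segment n d' k' m' =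
    (diag_segment n (d + d') (nat (max (int k) (int k' - d))) (nat (min (int m) (int m' - d)))
      :: 'a :: semiring_1 mat)"
    (is "?A * ?B = ?C")
proof (rule eq_matI)
  fix i j
  assume "i < dim_row ?C" "j < dim_col ?C"
  then have i: "i < n" and j: "j < n"
    by simp_all
  show "(?A * ?B) $$ (i, j) = ?C $$ (i, j)"
  proof (cases "0 \<le> int i + d \<and> int i + d < int n")
    case True
    then show ?thesis
      using i j
      by (subst index_diag_segment_mult[OF diag_segment_carrier i j])
         (auto simp: index_diag_segment nat_le_iff)
  next
    case False
    then have "\<not> (int k' - d \<le> int i + 1 \<and> int i + 1 \<le> int m' - d)"
      using assms by linarith
    with False show ?thesis
      by (subst index_diag_segment_mult[OF diag_segment_carrier i j])
         (auto simp: index_diag_segment i j)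
  qed
qed simp_all

lemma idempotent_diag_segment:
  assumes "1 \<le> k" "m \<le> n"
  shows "idempotent_mat (diag_segment n 0 k m)"
  using assms by (simp add: idempotent_mat_def diag_segment_mult)

lemma diag_segment_pow_Suc:
  assumes "1 \<le> k" "m \<le> n"
  shows "diag_segment n d k m ^\<^sub>m Suc r =
    diag_segment n (int (Suc r) * d)
      (nat (max (int k) (int k - int r * d))) (nat (min (int m) (int m - int r * d)))"
proof (induction r)
  case 0
  show ?case
    by simp
next
  case (Suc r)
  have between: "0 \<le> int r * d \<and> int r * d \<le> int (Suc r) * d \<or>
      int (Suc r) * d \<le> int r * d \<and> int r * d \<le> 0"
    by (cases "0 \<le> d") (auto simp: mult_nonneg_nonpos distrib_right)
  have lower: "max (int (nat (max (int k) (int k - int r * d)))) (int k - int (Suc r) * d) =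
      max (int k) (int k - int (Suc r) * d)"
    using between by linarith
  have upper: "nat (min (int (nat (min (int m) (int m - int r * d)))) (int m - int (Suc r) * d)) =
      nat (min (int m) (int m - int (Suc r) * d))"
    using between by linarith
  have shift: "int (Suc r) * d + d = int (Suc (Suc r)) * d"
    by (simp add: algebra_simps)
  show ?case
    unfolding pow_mat.simps(2)[of _ "Suc r"] Suc.IH diag_segment_mult[OF assms] lower upper shift ..
qed

lemma diag_segment_eq_zero_iff:
  "(diag_segment n d k m :: 'a :: semiring_1 mat) = 0\<^sub>m n n \<longleftrightarrow>
    min (int m) (int n - max 0 d) < max (int k) (1 - min 0 d)"
    (is "?A = _ \<longleftrightarrow> ?last < ?first")
proof
  assume zero: "?A = 0\<^sub>m n n"
  show "?last < ?first"
  proof (rule ccontr)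
    assume nonempty: "\<not> ?last < ?first"
    define i where "i = nat (?first - 1)"
    define j where "j = nat (int i + d)"
    have "i < n" "j < n" "k \<le> i + 1" "i + 1 \<le> m" "int j - int i = d"
      using nonempty unfolding i_def j_def by linarith+
    then have "?A $$ (i, j) = 1"
      by (simp add: index_diag_segment)
    with zero \<open>i < n\<close> \<open>j < n\<close> show False
      by simp
  qed
next
  assume "?last < ?first"
  then have "\<not> (k \<le> i + 1 \<and> i + 1 \<le> m \<and> int j - int i = d)" if "i < n" "j < n" for i j
    using that by linarith
  then show "?A = 0\<^sub>m n n"
    by (intro eq_matI) (auto simp: index_diag_segment)
qed

lemma diag_paramsD:
  assumes "diag_params n d k m"
  shows "1 \<le> k" "k \<le> m" "m \<le> n" "int m - int k + 1 \<le> int n - \<bar>d\<bar>"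
  using assms by (auto simp: diag_params_def min_def max_def split: if_splits)

lemma diag_segment_pow_eq_zero_iff:
  assumes params: "diag_params n d k m"
  shows "(diag_segment n d k m :: 'a :: semiring_1 mat) ^\<^sub>m r = 0\<^sub>m n n \<longleftrightarrow>
    int m - int k < (int r - 1) * \<bar>d\<bar>"
proof (cases r)
  case 0
  have "(1\<^sub>m n :: 'a mat) $$ (0, 0) \<noteq> 0\<^sub>m n n $$ (0, 0)"
    using diag_paramsD[OF params] by simp
  then have "(1\<^sub>m n :: 'a mat) \<noteq> 0\<^sub>m n n"
    by metis
  with 0 show ?thesis
    using diag_paramsD(2)[OF params] by simp
next
  case (Suc s)
  let ?lower = "nat (max (int k) (int k - int s * d))"
  let ?upper = "nat (min (int m) (int m - int s * d))"
  have "(diag_segment n d k m :: 'a mat) ^\<^sub>m r = 0\<^sub>m n n \<longleftrightarrow>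
      min (int ?upper) (int n - max 0 (int s * d + d)) <
      max (int ?lower) (1 - min 0 (int s * d + d))"
    unfolding Suc diag_segment_pow_Suc[OF diag_paramsD(1,3)[OF params]] diag_segment_eq_zero_iff
    by (simp add: algebra_simps)
  also have "\<dots> \<longleftrightarrow> int m - int k < \<bar>int s * d\<bar>"
  proof (cases "0 \<le> d")
    case True
    then have "0 \<le> int s * d"
      by simp
    with True params show ?thesis
      by (auto simp: diag_params_def)
  next
    case False
    then have "int s * d \<le> 0"
      by (simp add: mult_nonneg_nonpos)
    with False params show ?thesis
      by (auto simp: diag_params_def)
  qed
  finally show ?thesis
    by (simp add: Suc abs_mult)
qed

lemma nilpotent_matI:
  assumes "A \<in> carrier_mat n n" "A ^\<^sub>m j = 0\<^sub>m n n"
  shows "nilpotent_mat A"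
  using assms by (auto simp: nilpotent_mat_def)

lemma nilpotency_index_eqI:
  assumes "A \<in> carrier_mat n n" "\<And>j. A ^\<^sub>m j = 0\<^sub>m n n \<longleftrightarrow> l \<le> j"
  shows "nilpotency_index A = l"
  using assms by (auto simp: nilpotency_index_def intro: Least_equality)

lemma ceiling_divide_of_int_le_iff:
  assumes "0 < b"
  shows "\<lceil>of_int a / of_int b :: 'a :: floor_ceiling\<rceil> \<le> x \<longleftrightarrow> a \<le> x * b"
proof -
  have "\<lceil>of_int a / of_int b :: 'a\<rceil> \<le> x \<longleftrightarrow> (of_int a :: 'a) \<le> of_int (x * b)"
    using assms by (simp add: ceiling_le_iff pos_divide_le_eq)
  then show ?thesis
    unfolding of_int_le_iff .
qed

text \<open>
  For \<open>d \<noteq> 0\<close> this is the largest number of terms that an arithmetic progression with common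
  difference \<open>d\<close> can have inside \<open>{k..m}\<close>.
\<close>

definition orbit_length :: "int \<Rightarrow> nat \<Rightarrow> nat \<Rightarrow> int" where
  "orbit_length d k m = \<lceil>(real m - real k + 1) / real_of_int \<bar>d\<bar>\<rceil>"

lemma orbit_length_le_iff:
  assumes "d \<noteq> 0"
  shows "orbit_length d k m \<le> x \<longleftrightarrow> int m - int k < x * \<bar>d\<bar>"
  using ceiling_divide_of_int_le_iff[where ?'a = real, of "\<bar>d\<bar>" "int m - int k + 1" x] assms
  by (auto simp: orbit_length_def)

lemma orbit_length_ge_1:
  assumes "d \<noteq> 0" "k \<le> m"
  shows "1 \<le> orbit_length d k m"
  using orbit_length_le_iff[OF assms(1), of k m 0] assms(2) by linarith

lemma orbit_length_less:
  assumes "d \<noteq> 0" "diag_params n d k m"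
  shows "orbit_length d k m < int n"
proof -
  have "1 \<le> \<bar>d\<bar>"
    using assms(1) by linarith
  then have "int m - int k < int n - 1"
    using diag_paramsD(4)[OF assms(2)] by linarith
  also have "\<dots> \<le> (int n - 1) * \<bar>d\<bar>"
    using diag_paramsD[OF assms(2)] \<open>1 \<le> \<bar>d\<bar>\<close> by (simp add: mult_le_cancel_left1)
  finally have "orbit_length d k m \<le> int n - 1"
    unfolding orbit_length_le_iff[OF assms(1)] .
  then show ?thesis
    by simp
qed

lemma diag_segment_pow_eq_zero_iff_orbit_length:
  assumes "d \<noteq> 0" "diag_params n d k m"
  shows "(diag_segment n d k m :: 'a :: semiring_1 mat) ^\<^sub>m r = 0\<^sub>m n n \<longleftrightarrow>
    nat (1 + orbit_length d k m) \<le> r"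
  unfolding diag_segment_pow_eq_zero_iff[OF assms(2)] orbit_length_le_iff[OF assms(1), symmetric]
  by linarith

lemma nilpotent_diag_segment:
  assumes "d \<noteq> 0" "diag_params n d k m"
  shows "nilpotent_mat (diag_segment n d k m)"
  using diag_segment_pow_eq_zero_iff_orbit_length[OF assms]
  by (intro nilpotent_matI[OF diag_segment_carrier]) blast

lemma nilpotency_index_diag_segment:
  assumes "d \<noteq> 0" "diag_params n d k m"
  shows "int (nilpotency_index (diag_segment n d k m :: 'a :: semiring_1 mat)) =
    1 + orbit_length d k m"
proof -
  have "nilpotency_index (diag_segment n d k m :: 'a mat) = nat (1 + orbit_length d k m)"
    by (intro nilpotency_index_eqI[OF diag_segment_carrier]
        diag_segment_pow_eq_zero_iff_orbit_length assms)
  then show ?thesis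
    using orbit_length_ge_1[OF assms(1) diag_paramsD(2)[OF assms(2)]] by linarith
qed

theorem theorem4:
  fixes n k m :: nat and d :: int and A :: "'a :: semiring_1 mat"
  assumes "n \<ge> 2"
    and "diag_params n d k m"
    and "A = diag_segment n d k m"
    and "A \<in> diag_monoid n - {0\<^sub>m n n}"
  shows "(d = 0 \<longrightarrow> idempotent_mat A) \<and>
         (d \<noteq> 0 \<longrightarrow>
            nilpotent_mat A \<and>
            int (nilpotency_index A) = 1 + \<lceil>(real m - real k + 1) / real_of_int \<bar>d\<bar>\<rceil> \<and>
            2 \<le> nilpotency_index A \<and> nilpotency_index A \<le> n)"
proof (intro conjI[of "d = 0 \<longrightarrow> _"] impI)
  note params = diag_paramsD[OF assms(2)]
  show "idempotent_mat A" if "d = 0"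
    using idempotent_diag_segment[OF params(1,3)] that assms(3) by simp
  assume "d \<noteq> 0"
  have "nilpotent_mat A"
    using nilpotent_diag_segment[OF \<open>d \<noteq> 0\<close> assms(2)] assms(3) by simp
  moreover have "int (nilpotency_index A) = 1 + orbit_length d k m"
    using nilpotency_index_diag_segment[OF \<open>d \<noteq> 0\<close> assms(2)] assms(3) by simp
  moreover have "1 \<le> orbit_length d k m"
    using orbit_length_ge_1[OF \<open>d \<noteq> 0\<close> params(2)] .
  moreover have "orbit_length d k m < int n"
    using orbit_length_less[OF \<open>d \<noteq> 0\<close> assms(2)] .
  ultimately show "nilpotent_mat A \<and>
      int (nilpotency_index A) = 1 + \<lceil>(real m - real k + 1) / real_of_int \<bar>d\<bar>\<rceil> \<and>
      2 \<le> nilpotency_index A \<and> nilpotency_index A \<le> n"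
    unfolding orbit_length_def by linarith
qed

end
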